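(* Let $v_n$ be the coefficients of the asymptotic expansion $V(z)\sim\sum_{n=0}^\infty v_nz^n$ as $z\to0^+$, where $V(z)=\log z+\psi(z+1/z)$. Then for every integer $n\ge 1$, $$v_{2n-1}=\frac{(-1)^n}{2},\qquad v_{2n}=(-1)^{n+1}\left[\frac1n+\sum_{k=1}^n(-1)^k\binom{n+k-1}{n-k}\frac{B_{2k}}{2k}\right].$$
   Context: $\psi(z)=\Gamma'(z)/\Gamma(z)$ is the digamma function. $V(z)\sim\sum_{n\ge0} v_nz^n$ as $z\to0^+$ means that for every $N\ge 0$, $V(z)=\sum_{n=0}^N v_nz^n+O(z^{N+1})$ as $z\to 0^+$. The Bernoulli numbers $B_n$ are defined by $\frac{t}{e^t-1}=\sum_{n\ge 0} B_n\frac{t^n}{n!}$. *)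

theory Defs
  imports "HOL-Analysis.Analysis" "HOL-Library.Landau_Symbols"
begin

text \<open>Exponential generating function $t / (e^t - 1)$, read as a quotient of formal power
  series; the convention is therefore $B_1 = -1/2$.\<close>

definition bernoulli :: "nat \<Rightarrow> real" where
  "bernoulli n = fact n * fps_nth (fps_X / (fps_exp 1 - 1)) n"

lemma bernoulli_egf: "Abs_fps (\<lambda>n. bernoulli n / fact n) * (fps_exp 1 - 1) = fps_X"
proof -
  have eq: "Abs_fps (\<lambda>n. bernoulli n / fact n) = fps_X / (fps_exp 1 - 1)"
    by (rule fps_ext) (simp add: bernoulli_def)
  have nz: "fps_nth (fps_exp (1::real) - 1) 1 \<noteq> 0"
    by simp
  then have ne: "fps_exp (1::real) - 1 \<noteq> 0"
    by (metis fps_zero_nth)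
  have "subdegree (fps_exp (1::real) - 1) = 1"
    by (rule subdegreeI) (use nz in auto)
  then have "(fps_exp (1::real) - 1) dvd fps_X"
    by (subst fps_dvd_iff[OF ne]) auto
  then show ?thesis
    unfolding eq by (rule dvd_div_mult_self)
qed

definition has_asymp_expansion_at_right_0 :: "(real \<Rightarrow> real) \<Rightarrow> (nat \<Rightarrow> real) \<Rightarrow> bool" where
  "has_asymp_expansion_at_right_0 f c \<longleftrightarrow>
     (\<forall>N. (\<lambda>z. f z - (\<Sum>n=0..N. c n * z ^ n)) \<in> O[at_right 0](\<lambda>z. z ^ (N + 1)))"

definition V :: "real \<Rightarrow> real" where
  "V z = ln z + Digamma (z + 1 / z)"

end

theory Submission
  imports Defs "HOL-Computational_Algebra.Formal_Laurent_Series"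
begin

text \<open>Put \<open>x = z + 1/z = (1 + z\<^sup>2)/z\<close>. Stirling's expansion
  \<open>\<psi>(x) \<sim> ln x + \<Sum> c\<^sub>n x\<^sup>-\<^sup>n\<close> with \<open>c\<^sub>n = -(-1)\<^sup>n B\<^sub>n / n\<close> turns \<open>V(z)\<close> into
  \<open>ln (1 + z\<^sup>2) + \<Sum> c\<^sub>n z\<^sup>n (1 + z\<^sup>2)\<^sup>-\<^sup>n\<close>, and the coefficients are read off from the binomial series.
  Stirling's expansion itself follows from \<open>\<psi>(x + 1) - \<psi>(x) = 1/x\<close>: by the recurrence of the
  Bernoulli numbers the truncated expansion satisfies this equation up to \<open>O(x\<^sup>-\<^sup>M\<^sup>-\<^sup>2)\<close>, and a function
  that tends to 0 along \<open>x + \<nat>\<close> and has differences \<open>O(x\<^sup>-\<^sup>p\<^sup>-\<^sup>1)\<close> is itself \<open>O(x\<^sup>-\<^sup>p)\<close>.\<close>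

section \<open>Bernoulli numbers: recurrence and vanishing at odd indices\<close>

text \<open>Compare coefficients of \<open>t^m\<close> in the generating function identity and
  multiply by \<open>m!\<close>. Since \<open>e^t - 1\<close> has no constant term, the Cauchy
  product stops at \<open>i = m - 1\<close>.\<close>

lemma bernoulli_recurrence:
  "(\<Sum>i<m. real (m choose i) * bernoulli i) = (if m = 1 then 1 else 0)"
proof -
  have "(if m = 1 then 1 else 0 :: real) =
      fact m * fps_nth (Abs_fps (\<lambda>n. bernoulli n / fact n) * (fps_exp 1 - 1)) m"
    by (subst bernoulli_egf) (simp add: fps_X_def)
  also have "\<dots> = (\<Sum>i\<le>m. if i < m then real (m choose i) * bernoulli i else 0)"
    unfolding fps_mult_nth sum_distrib_left atLeast0AtMost
    by (intro sum.cong refl) (auto simp: binomial_fact)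
  also have "\<dots> = (\<Sum>i<m. real (m choose i) * bernoulli i)"
    by (intro sum.mono_neutral_cong_right) auto
  finally show ?thesis ..
qed

text \<open>With \<open>G = t / (e^t - 1)\<close>, replacing \<open>t\<close> by \<open>-t\<close>
  gives \<open>H = t e^t / (e^t - 1) = G + t\<close>. Comparing coefficients fixes
  \<open>B_1\<close> and kills all other odd indices.\<close>

lemma bernoulli_reflect: "(- 1) ^ n * bernoulli n = bernoulli n + (if n = 1 then 1 else 0)"
proof -
  define G where "G = Abs_fps (\<lambda>n. bernoulli n / fact n)"
  define H where "H = G oo (fps_const (- 1) * fps_X)"
  have exp_ne: "fps_exp (1::real) - 1 \<noteq> 0"
    using bernoulli_egf by (metis fps_X_neq_zero mult_zero_right)
  have "H * ((fps_exp 1 - 1) oo (fps_const (- 1) * fps_X)) = fps_X oo (fps_const (- 1) * fps_X)"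
    unfolding H_def G_def by (subst fps_compose_mult_distrib [symmetric]) (auto simp: bernoulli_egf)
  then have "H * (fps_exp (- 1) - 1) = - fps_X"
    by (simp add: fps_compose_sub_distrib fps_const_neg [symmetric] del: fps_const_neg)
  \<comment> \<open>Multiplying by \<open>e^t\<close> turns the factor \<open>e^(-t) - 1\<close>
    into \<open>1 - e^t\<close>, so \<open>H\<close> and \<open>G\<close> can be compared over the
    same denominator.\<close>
  then have "H * (fps_exp (- 1) - 1) * fps_exp 1 = - fps_X * fps_exp 1"
    by simp
  moreover have "fps_exp (- 1) * fps_exp (1::real) = 1"
    by (simp flip: fps_exp_add_mult)
  ultimately have "H * (fps_exp 1 - 1) = fps_X * fps_exp 1"
    by (simp add: algebra_simps)
  also have "\<dots> = (G + fps_X) * (fps_exp 1 - 1)"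
    using bernoulli_egf unfolding G_def by (simp add: algebra_simps)
  finally have "H = G + fps_X"
    using exp_ne by simp
  then have "fps_nth H n = fps_nth (G + fps_X) n"
    by simp
  then show ?thesis
    unfolding H_def fps_nth_compose_linear by (auto simp: G_def fps_X_def field_simps split: if_splits)
qed

lemma bernoulli_1: "bernoulli 1 = - 1 / 2"
  using bernoulli_reflect[of 1] by simp

lemma bernoulli_odd: "odd n \<Longrightarrow> n \<noteq> 1 \<Longrightarrow> bernoulli n = 0"
  using bernoulli_reflect[of n] by simp

section \<open>Power series at 0 and the Landau estimates they give\<close>

lemma gbinomial_minus_of_nat:
  assumes "n \<ge> 1"
  shows "(- real n) gchoose k = (- 1) ^ k * real ((n + k - 1) choose k)"
proof -
  have "real n + real k - 1 = real (n + k - 1)"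
    using assms by (simp add: of_nat_diff)
  then show ?thesis
    by (simp only: gbinomial_minus binomial_gbinomial)
qed

lemma has_fps_expansion_ln1p: "(\<lambda>x::real. ln (1 + x)) has_fps_expansion fps_ln 1"
proof (rule has_fps_expansionI)
  have "eventually (\<lambda>x::real. x \<in> ball 0 1) (nhds 0)"
    by (intro eventually_nhds_in_open) auto
  then show "\<forall>\<^sub>F x::real in nhds 0. (\<lambda>n. fps_nth (fps_ln 1) n * x ^ n) sums ln (1 + x)"
  proof eventually_elim
    case (elim x)
    have "(\<lambda>n. - ((- x) ^ n) / real n) = (\<lambda>n. fps_nth (fps_ln 1) n * x ^ n)"
    proof
      fix n
      show "- ((- x) ^ n) / real n = fps_nth (fps_ln 1) n * x ^ n"
        by (cases n) (auto simp: fps_ln_nth power_minus[of x])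
    qed
    then show ?case
      using ln_series'[of x] elim by simp
  qed
qed

lemma has_fps_expansion_power:
  fixes F :: "'a :: {banach, real_normed_div_algebra, comm_ring_1} fps"
  assumes "f has_fps_expansion F"
  shows "(\<lambda>x. f x ^ n) has_fps_expansion F ^ n"
  by (induction n) (auto intro!: has_fps_expansion_mult assms)

lemma has_fps_expansion_inverse_1p_power:
  "(\<lambda>x::real. inverse ((1 + x) ^ n)) has_fps_expansion fps_binomial (- real n)"
  unfolding fps_binomial_minus_of_nat
  by (intro has_fps_expansion_inverse has_fps_expansion_power fps_expansion_intros) simp

text \<open>The substituted series is the series of \<open>F\<close> at \<open>x^d\<close>, spread
  out over the multiples of \<open>d\<close> with zeros in between; inserting these zeros does not
  change the sum.\<close>

lemma has_fps_expansion_compose_power: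
  fixes f :: "'a :: {banach, real_normed_field} \<Rightarrow> 'a"
  assumes "f has_fps_expansion F" "d > 0"
  shows "(\<lambda>x. f (x ^ d)) has_fps_expansion (F oo fps_X ^ d)"
proof (rule has_fps_expansionI)
  have "eventually (\<lambda>x. x \<in> eball 0 (fps_conv_radius F)) (nhds 0)"
    using assms(1) by (intro eventually_nhds_in_open) (auto simp: has_fps_expansion_def zero_ereal_def)
  then have "eventually (\<lambda>x. (\<lambda>n. fps_nth F n * x ^ n) sums f x) (nhds 0)"
    using assms(1) unfolding has_fps_expansion_def
    by (auto elim!: eventually_elim2 dest!: sums_eval_fps)
  moreover have "filterlim (\<lambda>x::'a. x ^ d) (nhds 0) (nhds 0)"
    using assms(2) tendsto_power[OF filterlim_ident[of "nhds (0::'a)"], of d] by (simp add: zero_power)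
  ultimately have "eventually (\<lambda>x. (\<lambda>n. fps_nth F n * (x ^ d) ^ n) sums f (x ^ d)) (nhds 0)"
    by (rule eventually_compose_filterlim)
  then show "\<forall>\<^sub>F x in nhds 0. (\<lambda>n. fps_nth (F oo fps_X ^ d) n * x ^ n) sums f (x ^ d)"
  proof eventually_elim
    case (elim x)
    have "(\<lambda>n. fps_nth (F oo fps_X ^ d) (d * n) * x ^ (d * n)) sums f (x ^ d)"
      using elim assms(2) by (simp add: fps_nth_compose_X_power power_mult)
    moreover have "fps_nth (F oo fps_X ^ d) n * x ^ n = 0" if "n \<notin> range ((*) d)" for n
      using that by (auto simp: fps_nth_compose_X_power dvd_def)
    moreover have "strict_mono ((*) d)"
      using assms(2) by (simp add: strict_mono_def)
    ultimately show ?case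
      using sums_mono_reindex[of "(*) d" "\<lambda>n. fps_nth (F oo fps_X ^ d) n * x ^ n"] by blast
  qed
qed

text \<open>The series can be divided by \<open>x^N\<close>; the quotient is continuous at 0, so
  \<open>f x / x ^ N\<close> has a finite limit. The zero series is treated apart because its
  \<open>subdegree\<close> is 0 by convention.\<close>

lemma has_fps_expansion_imp_bigo:
  fixes f :: "'a :: {banach, real_normed_field} \<Rightarrow> 'a"
  assumes f: "f has_fps_expansion F" and F: "\<And>n. n < N \<Longrightarrow> fps_nth F n = 0"
  shows "f \<in> O[at 0](\<lambda>x. x ^ N)"
proof (cases "F = 0")
  case True
  then have "\<forall>\<^sub>F x in nhds 0. f x = 0"
    using f by (auto simp: has_fps_expansion_def elim!: eventually_mono)
  then have "\<forall>\<^sub>F x in at 0. f x = 0"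
    by (simp add: eventually_at_filter eventually_mono)
  then show ?thesis
    by (subst landau_o.big.in_cong) auto
next
  case False
  then have "N \<le> subdegree F"
    by (metis F linorder_not_le nth_subdegree_nonzero)
  from has_fps_expansion_shift[OF f this refl]
  have "isCont (\<lambda>x. if x = 0 then fps_nth F N else f x / x ^ N) 0"
    by (rule has_fps_expansion_imp_continuous)
  then have "((\<lambda>x. if x = 0 then fps_nth F N else f x / x ^ N) \<longlongrightarrow> fps_nth F N) (at 0)"
    by (simp add: isCont_def)
  then have "((\<lambda>x. f x / x ^ N) \<longlongrightarrow> fps_nth F N) (at 0)"
    by (rule Lim_transform_eventually) (auto simp: eventually_at_filter)
  then show ?thesis
    by (rule bigoI_tendsto) (intro eventually_mono[OF eventually_neq_at_within[of 0]], simp)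
qed

lemma has_fps_expansion_imp_asymp:
  fixes f :: "real \<Rightarrow> real"
  assumes "f has_fps_expansion F"
  shows "(\<lambda>x. f x - (\<Sum>n=0..N. fps_nth F n * x ^ n)) \<in> O[at_right 0](\<lambda>x. x ^ (N + 1))"
proof -
  let ?P = "\<Sum>n=0..N. fps_const (fps_nth F n) * fps_X ^ n"
  have "(\<lambda>x. f x - (\<Sum>n=0..N. fps_nth F n * x ^ n)) has_fps_expansion F - ?P"
    by (intro fps_expansion_intros assms)
  moreover have "fps_nth (F - ?P) n = 0" if "n < N + 1" for n
    using that by (simp add: fps_sum_nth fps_X_power_nth if_distrib[of "(*) _"] cong: if_cong)
  ultimately have "(\<lambda>x. f x - (\<Sum>n=0..N. fps_nth F n * x ^ n)) \<in> O[at 0](\<lambda>x. x ^ (N + 1))"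
    by (rule has_fps_expansion_imp_bigo)
  then show ?thesis
    using landau_o.big.filter_mono[of "at_right 0" "at (0::real)"] by (auto simp: at_le)
qed

section \<open>Truncated Stirling expansion and its difference equation\<close>

text \<open>For \<open>n \<ge> 1\<close> the factor \<open>(-1)^n\<close> matters only at
  \<open>n = 1\<close>, where it compensates for the convention \<open>B_1 = -1/2\<close>.\<close>

definition digamma_coeff :: "nat \<Rightarrow> real" where
  "digamma_coeff n = - ((- 1) ^ n * bernoulli n / real n)"

definition digamma_approx :: "nat \<Rightarrow> real \<Rightarrow> real" where
  "digamma_approx M x = ln x + (\<Sum>n=1..M. digamma_coeff n / x ^ n)"

text \<open>This is the coefficient of \<open>w^m\<close> in the formal identity
  \<open>ln (1 + w) + \<Sum> c_n w^n ((1 + w)^(-n) - 1) = w\<close>. The absorption rule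
  \<open>(1/n) C(m-1, m-n) = (1/m) C(m, n)\<close> reduces it to the Bernoulli recurrence, whose
  missing term \<open>B_0 = 1\<close> cancels the coefficient of the logarithm.\<close>

lemma digamma_coeff_recurrence:
  assumes "m \<ge> 1"
  shows "(- 1) ^ (m - 1) / real m +
    (\<Sum>n\<in>{1..<m}. digamma_coeff n * ((- real n) gchoose (m - n))) = (if m = 1 then 1 else 0)"
proof -
  have term_eq: "digamma_coeff n * ((- real n) gchoose (m - n)) =
      - ((- 1) ^ m / real m) * (real (m choose n) * bernoulli n)" if "n \<in> {1..<m}" for n
  proof -
    from that have n: "1 \<le> n" "n < m"
      by auto
    have "n * (m choose n) = m * ((m - 1) choose (n - 1))"
      using n times_binomial_minus1_eq[of n m] by simp
    also have "(m - 1) choose (n - 1) = (m - 1) choose (m - n)"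
      using n binomial_symmetric[of "n - 1" "m - 1"] by simp
    finally have "real n * real (m choose n) = real m * real ((m - 1) choose (m - n))"
      by (metis of_nat_mult)
    then have binom: "real ((m - 1) choose (m - n)) / real n = real (m choose n) / real m"
      using n by (simp add: field_simps)
    have sign: "(- 1) ^ n * (- 1) ^ (m - n) = (- 1 :: real) ^ m"
      using n by (simp flip: power_add)
    have gbinom: "(- real n) gchoose (m - n) = (- 1) ^ (m - n) * real ((m - 1) choose (m - n))"
      using n gbinomial_minus_of_nat[of n "m - n"] by simp
    have "digamma_coeff n * ((- real n) gchoose (m - n)) =
        - (((- 1) ^ n * (- 1) ^ (m - n)) * (real ((m - 1) choose (m - n)) / real n) * bernoulli n)"
      unfolding digamma_coeff_def gbinom by simp
    then show ?thesis
      unfolding sign binom by simp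
  qed
  have "(\<Sum>n\<in>{1..<m}. digamma_coeff n * ((- real n) gchoose (m - n))) =
      - ((- 1) ^ m / real m) * (\<Sum>n\<in>{1..<m}. real (m choose n) * bernoulli n)"
    unfolding sum_distrib_left by (intro sum.cong refl term_eq)
  also have "(\<Sum>n\<in>{1..<m}. real (m choose n) * bernoulli n) =
      (\<Sum>n<m. real (m choose n) * bernoulli n) - bernoulli 0"
    using assms by (simp add: sum.atLeast_Suc_lessThan lessThan_atLeast0)
  also have "\<dots> = (if m = 1 then 1 else 0) - bernoulli 0"
    by (simp only: bernoulli_recurrence)
  also have "bernoulli 0 = 1"
    using bernoulli_recurrence[of 1] by simp
  finally show ?thesis
    using assms by (cases m) (auto simp: field_simps)
qed

lemma digamma_approx_step:
  "(\<lambda>x. digamma_approx M (x + 1) - digamma_approx M x - 1 / x) \<in> O[at_top](\<lambda>x. 1 / x ^ (M + 2))"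
proof -
  \<comment> \<open>The expression to be estimated, rewritten in \<open>w = 1/x\<close> using
    \<open>1/(x + 1)^n = w^n (1 + w)^(-n)\<close>.\<close>
  define g where "g = (\<lambda>w. ln (1 + w) +
    (\<Sum>n=1..M. digamma_coeff n * (w ^ n * (inverse ((1 + w) ^ n) - 1))) - w)"
  define G where "G = fps_ln 1 +
    (\<Sum>n=1..M. fps_const (digamma_coeff n) * (fps_X ^ n * (fps_binomial (- real n) - 1))) - fps_X"
  have g: "g has_fps_expansion G"
    unfolding g_def G_def
    by (intro fps_expansion_intros has_fps_expansion_ln1p has_fps_expansion_inverse_1p_power)
  have G: "fps_nth G m = 0" if "m < M + 2" for m
  proof (cases "m = 0")
    case False
    have "fps_nth G m = (- 1) ^ (m - 1) / real m +
        (\<Sum>n=1..M. digamma_coeff n *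
          (if m < n then 0 else ((- real n) gchoose (m - n)) - (if m = n then 1 else 0))) -
        (if m = 1 then 1 else 0)"
      using False
      by (auto simp: G_def fps_sum_nth fps_X_power_mult_nth fps_ln_nth intro!: sum.cong)
    \<comment> \<open>Terms with \<open>n > m\<close> vanish, and at \<open>n = m\<close> the
      subtracted 1 cancels the leading binomial coefficient. Since \<open>m \<le> M + 1\<close>,
      every \<open>n < m\<close> is within the truncation, so the full recurrence is
      available.\<close>
    also have "(\<Sum>n=1..M. digamma_coeff n *
          (if m < n then 0 else ((- real n) gchoose (m - n)) - (if m = n then 1 else 0))) =
        (\<Sum>n\<in>{1..<m}. digamma_coeff n * ((- real n) gchoose (m - n)))"
      using that by (intro sum.mono_neutral_cong_right) auto
    finally show ?thesis
      using digamma_coeff_recurrence[of m] False by simp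
  qed (auto simp: G_def fps_sum_nth fps_X_power_mult_nth)
  have "g \<in> O[at 0](\<lambda>w. w ^ (M + 2))"
    using g G by (rule has_fps_expansion_imp_bigo)
  then have "g \<in> O[at_right 0](\<lambda>w. w ^ (M + 2))"
    by (rule landau_o.big.filter_mono[rotated]) (simp add: at_le)
  moreover have "filterlim (\<lambda>x::real. 1 / x) (at_right 0) at_top"
    using filterlim_inverse_at_right_top by (simp add: inverse_eq_divide)
  ultimately have "(\<lambda>x. g (1 / x)) \<in> O[at_top](\<lambda>x. (1 / x) ^ (M + 2))"
    by (rule landau_o.big.compose)
  moreover have "\<forall>\<^sub>F x in at_top. g (1 / x) = digamma_approx M (x + 1) - digamma_approx M x - 1 / x"
    using eventually_gt_at_top[of 0]
  proof eventually_elim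
    case (elim x)
    have w: "1 + 1 / x = (x + 1) / x"
      using elim by (simp add: field_simps)
    have "(1 / x) ^ n * (inverse ((1 + 1 / x) ^ n) - 1) = 1 / (x + 1) ^ n - 1 / x ^ n" for n
      using elim unfolding w by (simp add: power_divide field_simps)
    moreover have "ln (1 + 1 / x) = ln (x + 1) - ln x"
      using elim unfolding w by (simp add: ln_div)
    ultimately show ?case
      unfolding g_def digamma_approx_def
      by (simp only:) (simp add: right_diff_distrib sum_subtractf)
  qed
  ultimately show ?thesis
    by (subst (asm) landau_o.big.in_cong) (simp_all add: power_divide)
qed

section \<open>From the difference equation to Stirling's expansion\<close>

text \<open>The bound on differences determines \<open>f\<close> only up to 1-periodic functions;
  the limit along \<open>x + \<nat>\<close> excludes those. Summing the tail of the differences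
  costs one power of \<open>x\<close>; a monotone comparison replaces the summation.\<close>

lemma bigo_at_top_if_difference_bigo:
  fixes f :: "real \<Rightarrow> real"
  assumes lim: "\<And>x. x > 0 \<Longrightarrow> (\<lambda>k. f (x + real k)) \<longlonglongrightarrow> 0"
    and diff: "(\<lambda>x. f (x + 1) - f x) \<in> O[at_top](\<lambda>x. 1 / x ^ (p + 1))" and p: "p \<ge> 1"
  shows "f \<in> O[at_top](\<lambda>x. 1 / x ^ p)"
proof -
  from diff obtain C where C: "C > 0"
    "\<forall>\<^sub>F x in at_top. norm (f (x + 1) - f x) \<le> C * norm (1 / x ^ (p + 1))"
    by (elim landau_o.bigE)
  then obtain X where X: "\<And>x. x \<ge> X \<Longrightarrow> norm (f (x + 1) - f x) \<le> C * norm (1 / x ^ (p + 1))"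
    unfolding eventually_at_top_linorder by blast
  have half_diff: "c \<le> 2 * b - 2 * a" if "a \<le> b - c / 2" for a b c :: real
    using that by linarith
  \<comment> \<open>\<open>h\<close> increases along \<open>x, x + 1, \<dots>\<close> because \<open>x\<^sup>-\<^sup>p - (x + 1)\<^sup>-\<^sup>p \<ge> x\<^sup>-\<^sup>p\<^sup>-\<^sup>1 / 2\<close>, so its limit 0 bounds it above.\<close>
  define h where "h = (\<lambda>x. \<bar>f x\<bar> - 2 * C / x ^ p)"
  have h_step: "h x \<le> h (x + 1)" if x: "x \<ge> X" "x \<ge> 1" for x
  proof -
    have "x ^ p * (x + 1) \<le> (x + 1) ^ p * x"
    proof -
      obtain q where q: "p = Suc q"
        using p by (cases p) auto
      have "x ^ q \<le> (x + 1) ^ q"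
        using x by (intro power_mono) auto
      then show ?thesis
        using x mult_right_mono[of "x ^ q" "(x + 1) ^ q" "x * (x + 1)"] by (simp add: q mult_ac)
    qed
    then have "1 / (x + 1) ^ p \<le> x / (x ^ p * (x + 1))"
      using x by (simp add: divide_simps mult_ac)
    also have "\<dots> = 1 / x ^ p - 1 / (x ^ p * (x + 1))"
    proof -
      have "x / (a * (x + 1)) = 1 / a - 1 / (a * (x + 1))" if "a > 0" for a
        using that x by (simp add: divide_simps)
      then show ?thesis
        using x by simp
    qed
    \<comment> \<open>Here \<open>x + 1 \<le> 2 * x\<close>, from \<open>x \<ge> 1\<close>, costs
      the factor 1/2 that the constant \<open>2 * C\<close> in \<open>h\<close> makes up
      for.\<close>
    also have "\<dots> \<le> 1 / x ^ p - 1 / x ^ (p + 1) / 2"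
    proof -
      have "x ^ p * (x + 1) \<le> x ^ p * (2 * x)"
        using x by (intro mult_left_mono) auto
      then show ?thesis
        using x unfolding divide_divide_eq_left
        by (intro diff_left_mono frac_le) (auto simp: mult_ac)
    qed
    finally have "1 / x ^ (p + 1) \<le> 2 * (1 / x ^ p) - 2 * (1 / (x + 1) ^ p)"
      using half_diff by blast
    then have "C * (1 / x ^ (p + 1)) \<le> C * (2 * (1 / x ^ p) - 2 * (1 / (x + 1) ^ p))"
      using C(1) by (intro mult_left_mono) auto
    then have "C / x ^ (p + 1) \<le> 2 * C / x ^ p - 2 * C / (x + 1) ^ p"
      by (simp add: right_diff_distrib mult_ac)
    moreover have "\<bar>f (x + 1) - f x\<bar> \<le> C / x ^ (p + 1)"
      using X[of x] x by simp
    ultimately show ?thesis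
      unfolding h_def by linarith
  qed
  have bound: "\<bar>f x\<bar> \<le> 2 * C / x ^ p" if x: "x \<ge> X" "x \<ge> 1" for x
  proof -
    have "h x \<le> h (x + real k)" for k
    proof (induction k)
      case (Suc k)
      then show ?case
        using h_step[of "x + real k"] x by (simp add: add_ac)
    qed simp
    moreover have "(\<lambda>k. h (x + real k)) \<longlonglongrightarrow> 0"
    proof -
      have "filterlim (\<lambda>k. (x + real k) ^ p) at_top sequentially"
        using p by (intro filterlim_pow_at_top filterlim_tendsto_add_at_top[OF tendsto_const]
          filterlim_real_sequentially) auto
      then have "(\<lambda>k. 2 * C / (x + real k) ^ p) \<longlonglongrightarrow> 0"
        by (intro tendsto_divide_0[OF tendsto_const] filterlim_at_top_imp_at_infinity)
      moreover have "(\<lambda>k. \<bar>f (x + real k)\<bar>) \<longlonglongrightarrow> 0"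
        using lim[of x] x by (simp add: tendsto_rabs_zero)
      ultimately show ?thesis
        unfolding h_def using tendsto_diff by fastforce
    qed
    ultimately have "h x \<le> 0"
      using LIMSEQ_le_const by blast
    then show ?thesis
      by (simp add: h_def)
  qed
  have "\<forall>\<^sub>F x in at_top. norm (f x) \<le> (2 * C) * norm (1 / x ^ p)"
    using eventually_ge_at_top[of "max X 1"] by eventually_elim (use bound in auto)
  then show ?thesis
    by (rule bigoI)
qed

lemma Digamma_add_of_nat:
  fixes x :: real
  assumes "x > 0"
  shows "Digamma (x + real m) = Digamma x + (\<Sum>n<m. inverse (x + real n))"
proof (induction m)
  case (Suc m)
  have "Digamma (x + real m + 1) = Digamma (x + real m) + 1 / (x + real m)"
    using assms by (intro Digamma_plus1) auto
  with Suc show ?case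
    by (simp add: add_ac inverse_eq_divide)
qed simp

text \<open>The limit formula for \<open>Digamma x\<close>, combined with the shift by
  \<open>m\<close>, says that \<open>Digamma (x + m) - ln m\<close> tends to 0. Replacing
  \<open>ln m\<close> by \<open>ln (x + m)\<close> and adding the negative powers changes this by
  null sequences only.\<close>

lemma Digamma_minus_approx_lim:
  assumes x: "x > 0"
  shows "(\<lambda>k. Digamma (x + real k) - digamma_approx M (x + real k)) \<longlonglongrightarrow> 0"
proof -
  have "(\<lambda>m. Digamma x - (ln (real m) - (\<Sum>n<m. inverse (x + real n)))) \<longlonglongrightarrow> Digamma x - Digamma x"
    using Digamma_LIMSEQ[of x] x by (intro tendsto_intros) auto
  then have 1: "(\<lambda>m. Digamma (x + real m) - ln (real m)) \<longlonglongrightarrow> 0"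
    by (simp add: Digamma_add_of_nat[OF x] algebra_simps)
  have "(\<lambda>m. ln (1 + x / real m)) \<longlonglongrightarrow> ln (1 + 0)"
    by (intro tendsto_intros tendsto_divide_0[OF tendsto_const] filterlim_at_top_imp_at_infinity
      filterlim_real_sequentially) auto
  moreover have "\<forall>\<^sub>F m in sequentially. ln (1 + x / real m) = ln (x + real m) - ln (real m)"
    using eventually_gt_at_top[of 0]
  proof eventually_elim
    case (elim m)
    then have "1 + x / real m = (x + real m) / real m"
      by (simp add: field_simps)
    then show ?case
      using elim x by (simp add: ln_div)
  qed
  ultimately have 2: "(\<lambda>m. ln (x + real m) - ln (real m)) \<longlonglongrightarrow> 0"
    using Lim_transform_eventually by fastforce
  have "(\<lambda>m. digamma_coeff n / (x + real m) ^ n) \<longlonglongrightarrow> 0" if "n \<in> {1..M}" for n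
    using that
    by (intro tendsto_divide_0[OF tendsto_const] filterlim_at_top_imp_at_infinity
        filterlim_pow_at_top filterlim_tendsto_add_at_top[OF tendsto_const]
        filterlim_real_sequentially) auto
  then have 3: "(\<lambda>m. \<Sum>n=1..M. digamma_coeff n / (x + real m) ^ n) \<longlonglongrightarrow> 0"
    by (rule tendsto_null_sum)
  from tendsto_diff[OF tendsto_diff[OF 1 2] 3] show ?thesis
    by (simp add: digamma_approx_def algebra_simps)
qed

text \<open>\<open>Digamma\<close> satisfies the difference equation exactly, so the error has the
  differences of the approximation's defect with opposite sign.\<close>

lemma Digamma_asymp:
  "(\<lambda>x. Digamma x - digamma_approx M x) \<in> O[at_top](\<lambda>x. 1 / x ^ (M + 1))"
proof (rule bigo_at_top_if_difference_bigo)
  have "\<forall>\<^sub>F x::real in at_top.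
      - (digamma_approx M (x + 1) - digamma_approx M x - 1 / x) =
      (Digamma (x + 1) - digamma_approx M (x + 1)) - (Digamma x - digamma_approx M x)"
    using eventually_gt_at_top[of 0]
    by eventually_elim (simp add: Digamma_plus1)
  moreover have "(\<lambda>x. - (digamma_approx M (x + 1) - digamma_approx M x - 1 / x))
      \<in> O[at_top](\<lambda>x. 1 / x ^ (M + 1 + 1))"
    using digamma_approx_step[of M] by (subst landau_o.big.uminus_in_iff) simp
  ultimately show "(\<lambda>x. (Digamma (x + 1) - digamma_approx M (x + 1)) - (Digamma x - digamma_approx M x))
      \<in> O[at_top](\<lambda>x. 1 / x ^ (M + 1 + 1))"
    by (subst (asm) landau_o.big.in_cong)
qed (auto intro: Digamma_minus_approx_lim)

section \<open>Transfer of the expansion to \<open>V\<close>\<close>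

definition V_approx_fps :: "nat \<Rightarrow> real fps" where
  "V_approx_fps M = (fps_ln 1 oo fps_X ^ 2) +
    (\<Sum>n=1..M. fps_const (digamma_coeff n) * (fps_X ^ n * (fps_binomial (- real n) oo fps_X ^ 2)))"

lemma V_asymp_approx_fps:
  "(\<lambda>z. V z - (\<Sum>n=0..N. fps_nth (V_approx_fps N) n * z ^ n)) \<in> O[at_right 0](\<lambda>z. z ^ (N + 1))"
proof -
  define h where "h = (\<lambda>z::real. ln (1 + z ^ 2) +
    (\<Sum>n=1..N. digamma_coeff n * (z ^ n * inverse ((1 + z ^ 2) ^ n))))"
  have "h has_fps_expansion V_approx_fps N"
    unfolding h_def V_approx_fps_def
    by (intro fps_expansion_intros has_fps_expansion_compose_power[OF has_fps_expansion_ln1p]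
      has_fps_expansion_compose_power[OF has_fps_expansion_inverse_1p_power]) auto
  then have h: "(\<lambda>z. h z - (\<Sum>n=0..N. fps_nth (V_approx_fps N) n * z ^ n))
      \<in> O[at_right 0](\<lambda>z. z ^ (N + 1))"
    by (rule has_fps_expansion_imp_asymp)
  have "filterlim (\<lambda>z::real. z + 1 / z) at_top (at_right 0)"
    using filterlim_tendsto_add_at_top[OF tendsto_ident_at filterlim_inverse_at_top_right]
    by (simp add: inverse_eq_divide)
  with Digamma_asymp have "(\<lambda>z. Digamma (z + 1 / z) - digamma_approx N (z + 1 / z))
      \<in> O[at_right 0](\<lambda>z. 1 / (z + 1 / z) ^ (N + 1))"
    by (rule landau_o.big.compose)
  \<comment> \<open>For \<open>z > 0\<close>, \<open>z + 1/z \<ge> 1/z\<close>, so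
    \<open>1/x \<le> z\<close>.\<close>
  also have "(\<lambda>z. 1 / (z + 1 / z) ^ (N + 1)) \<in> O[at_right 0](\<lambda>z::real. z ^ (N + 1))"
  proof (rule landau_o.big_mono)
    show "\<forall>\<^sub>F z::real in at_right 0. norm (1 / (z + 1 / z) ^ (N + 1)) \<le> norm (z ^ (N + 1))"
      using eventually_at_right_less[of 0]
    proof eventually_elim
      case (elim z)
      have "1 / (z + 1 / z) \<le> 1 / (1 / z)"
        using elim by (intro frac_le) auto
      then have "(1 / (z + 1 / z)) ^ (N + 1) \<le> z ^ (N + 1)"
        using elim by (intro power_mono) auto
      then show ?case
        using elim by (simp add: power_divide abs_mult)
    qed
  qed
  finally have D: "(\<lambda>z. Digamma (z + 1 / z) - digamma_approx N (z + 1 / z))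
      \<in> O[at_right 0](\<lambda>z. z ^ (N + 1))" .
  have "\<forall>\<^sub>F z in at_right 0. (h z - (\<Sum>n=0..N. fps_nth (V_approx_fps N) n * z ^ n)) +
      (Digamma (z + 1 / z) - digamma_approx N (z + 1 / z)) =
      V z - (\<Sum>n=0..N. fps_nth (V_approx_fps N) n * z ^ n)"
    using eventually_at_right_less[of 0]
  proof eventually_elim
    case (elim z)
    have x: "z + 1 / z = (1 + z ^ 2) / z"
      using elim by (simp add: field_simps power2_eq_square)
    have pos: "1 + z ^ 2 > 0"
      by (simp add: add_pos_nonneg)
    have "ln (1 + z ^ 2) = ln z + ln (z + 1 / z)"
      using elim pos unfolding x by (simp add: ln_div)
    moreover have "z ^ n * inverse ((1 + z ^ 2) ^ n) = 1 / (z + 1 / z) ^ n" for n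
      unfolding x by (simp add: power_divide inverse_eq_divide)
    ultimately show ?case
      by (simp add: V_def h_def digamma_approx_def)
  qed
  with sum_in_bigo(1)[OF h D] show ?thesis
    by (subst (asm) landau_o.big.in_cong)
qed

text \<open>Truncating at \<open>m\<close> suffices: the \<open>n\<close>-th summand starts at
  \<open>z^n\<close>, so every \<open>M \<ge> m\<close> gives the same coefficient of
  \<open>z^m\<close>.\<close>

definition V_coeff :: "nat \<Rightarrow> real" where
  "V_coeff m = fps_nth (V_approx_fps m) m"

lemma V_approx_fps_nth:
  "fps_nth (V_approx_fps M) m = fps_nth (fps_ln 1 oo fps_X ^ 2) m +
    (\<Sum>n=1..M. if n \<le> m \<and> even (m - n)
      then digamma_coeff n * ((- real n) gchoose ((m - n) div 2)) else 0)"
  unfolding V_approx_fps_def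
  by (auto simp: fps_sum_nth fps_X_power_mult_nth fps_nth_compose_X_power intro!: sum.cong)

lemma V_approx_fps_nth_eq_V_coeff: "m \<le> M \<Longrightarrow> fps_nth (V_approx_fps M) m = V_coeff m"
  unfolding V_coeff_def V_approx_fps_nth
  by (intro arg_cong2[of _ _ _ _ "(+)"] refl sum.mono_neutral_right) auto

lemma V_has_asymp_expansion: "has_asymp_expansion_at_right_0 V V_coeff"
  unfolding has_asymp_expansion_at_right_0_def
proof
  fix N
  have "(\<Sum>n=0..N. V_coeff n * z ^ n) = (\<Sum>n=0..N. fps_nth (V_approx_fps N) n * z ^ n)" for z
    by (intro sum.cong) (auto simp: V_approx_fps_nth_eq_V_coeff)
  then show "(\<lambda>z. V z - (\<Sum>n=0..N. V_coeff n * z ^ n)) \<in> O[at_right 0](\<lambda>z. z ^ (N + 1))"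
    using V_asymp_approx_fps by simp
qed

section \<open>Closed forms of the coefficients\<close>

lemma digamma_coeff_1: "digamma_coeff 1 = - 1 / 2"
  unfolding digamma_coeff_def bernoulli_1 by simp

lemma digamma_coeff_odd: "odd n \<Longrightarrow> n \<noteq> 1 \<Longrightarrow> digamma_coeff n = 0"
  by (simp add: digamma_coeff_def bernoulli_odd)

text \<open>The logarithm and the binomial series involve only even powers of \<open>z\<close>, so
  only odd-indexed \<open>c_k\<close> contribute, and of these only \<open>c_1 = -1/2\<close> is
  nonzero.\<close>

lemma V_coeff_odd:
  assumes "n \<ge> 1"
  shows "V_coeff (2 * n - 1) = (- 1) ^ n / 2"
proof -
  have odd: "odd (2 * n - 1)" and half: "(2 * n - 1 - 1) div 2 = n - 1"
    using assms by auto
  have "V_coeff (2 * n - 1) = (\<Sum>k=1..2 * n - 1. if k \<le> 2 * n - 1 \<and> even (2 * n - 1 - k)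
      then digamma_coeff k * ((- real k) gchoose ((2 * n - 1 - k) div 2)) else 0)"
    unfolding V_coeff_def V_approx_fps_nth using odd by (simp add: fps_nth_compose_X_power)
  also have "\<dots> = (\<Sum>k\<in>{1}. digamma_coeff k * ((- real k) gchoose ((2 * n - 1 - k) div 2)))"
    using assms odd
    by (intro sum.mono_neutral_cong_right) (auto simp: digamma_coeff_odd)
  also have "\<dots> = - 1 / 2 * ((- real 1) gchoose (n - 1))"
    using half digamma_coeff_1 by simp
  also have "(- real 1) gchoose (n - 1) = (- 1) ^ (n - 1)"
    by (subst gbinomial_minus_of_nat) auto
  finally show ?thesis
    using assms by (cases n) auto
qed

text \<open>The logarithm supplies \<open>1/n\<close> up to sign. By parity only the
  \<open>c_(2k)\<close> remain, weighted by the coefficient of \<open>z^(2(n-k))\<close> in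
  \<open>(1 + z^2)^(-2k)\<close>.\<close>

lemma V_coeff_even:
  assumes "n \<ge> 1"
  shows "V_coeff (2 * n) = (- 1) ^ (n + 1) * (1 / real n +
    (\<Sum>k=1..n. (- 1) ^ k * real ((n + k - 1) choose (n - k)) * (bernoulli (2 * k) / real (2 * k))))"
proof -
  have term_eq: "digamma_coeff (2 * k) * ((- real (2 * k)) gchoose (n - k)) =
      (- 1) ^ (n + 1) * ((- 1) ^ k * real ((n + k - 1) choose (n - k)) *
        (bernoulli (2 * k) / real (2 * k)))" if "k \<in> {1..n}" for k
  proof -
    have "2 * k + (n - k) - 1 = n + k - 1"
      using that by simp
    moreover have "(- 1) ^ (n - k) = (- 1 :: real) ^ n * (- 1) ^ k"
      using that by (auto simp: minus_one_power_iff)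
    ultimately have "(- real (2 * k)) gchoose (n - k) =
        (- 1) ^ n * (- 1) ^ k * real ((n + k - 1) choose (n - k))"
      using gbinomial_minus_of_nat[of "2 * k" "n - k"] that by simp
    then show ?thesis
      by (simp add: digamma_coeff_def)
  qed
  have "V_coeff (2 * n) = (- 1) ^ (n - 1) / real n + (\<Sum>k=1..2 * n. if k \<le> 2 * n \<and> even (2 * n - k)
      then digamma_coeff k * ((- real k) gchoose ((2 * n - k) div 2)) else 0)"
    unfolding V_coeff_def V_approx_fps_nth
    using assms by (simp add: fps_nth_compose_X_power fps_ln_nth)
  also have "(\<Sum>k=1..2 * n. if k \<le> 2 * n \<and> even (2 * n - k)
      then digamma_coeff k * ((- real k) gchoose ((2 * n - k) div 2)) else 0) =
      (\<Sum>k\<in>(*) 2 ` {1..n}. digamma_coeff k * ((- real k) gchoose ((2 * n - k) div 2)))"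
    by (intro sum.mono_neutral_cong_right) (auto elim!: evenE)
  also have "\<dots> = (\<Sum>k=1..n. digamma_coeff (2 * k) * ((- real (2 * k)) gchoose (n - k)))"
    by (subst sum.reindex) (auto simp: inj_on_def simp flip: diff_mult_distrib2)
  also have "\<dots> = (- 1) ^ (n + 1) * (\<Sum>k=1..n. (- 1) ^ k * real ((n + k - 1) choose (n - k)) *
        (bernoulli (2 * k) / real (2 * k)))"
    unfolding sum_distrib_left by (intro sum.cong refl term_eq)
  also have "(- 1) ^ (n - 1) = (- 1 :: real) ^ (n + 1)"
    using assms by (cases n) auto
  finally show ?thesis
    by (simp add: algebra_simps)
qed

section \<open>Uniqueness of the expansion and conclusion\<close>

text \<open>Strong induction: once the earlier coefficients agree, subtracting the two expansions at
  order \<open>n\<close> leaves \<open>(c n - d n) * z ^ n = O(z^(n+1))\<close>. Dividing by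
  \<open>z^n\<close> and letting \<open>z\<close> tend to 0 from the right gives equality.\<close>

lemma has_asymp_expansion_unique:
  assumes "has_asymp_expansion_at_right_0 f c" "has_asymp_expansion_at_right_0 f d"
  shows "c = d"
proof
  fix n
  show "c n = d n"
  proof (induction n rule: less_induct)
    case (less n)
    have "(\<lambda>z. (f z - (\<Sum>k=0..n. d k * z ^ k)) - (f z - (\<Sum>k=0..n. c k * z ^ k)))
        \<in> O[at_right 0](\<lambda>z. z ^ (n + 1))"
      by (rule sum_in_bigo(2))
         (use assms in \<open>unfold has_asymp_expansion_at_right_0_def, blast+\<close>)
    also have "(\<lambda>z. (f z - (\<Sum>k=0..n. d k * z ^ k)) - (f z - (\<Sum>k=0..n. c k * z ^ k))) =
        (\<lambda>z. (c n - d n) * z ^ n)"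
    proof
      fix z
      have "(\<Sum>k=0..n. c k * z ^ k) - (\<Sum>k=0..n. d k * z ^ k) =
          (\<Sum>k=0..n. if k = n then (c n - d n) * z ^ n else 0)"
        unfolding sum_subtractf [symmetric]
        by (intro sum.cong refl) (auto simp: less algebra_simps)
      then show "(f z - (\<Sum>k=0..n. d k * z ^ k)) - (f z - (\<Sum>k=0..n. c k * z ^ k)) =
          (c n - d n) * z ^ n"
        by simp
    qed
    finally obtain C where C: "\<forall>\<^sub>F z::real in at_right 0. norm ((c n - d n) * z ^ n) \<le> C * norm (z ^ (n + 1))"
      by (elim landau_o.bigE)
    have "\<forall>\<^sub>F z::real in at_right 0. \<bar>c n - d n\<bar> \<le> C * z"
      using C eventually_at_right_less[of 0]
    proof eventually_elim
      case (elim z)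
      then have "\<bar>c n - d n\<bar> * z ^ n \<le> (C * z) * z ^ n"
        by (simp add: abs_mult mult_ac)
      then show ?case
        using elim by simp
    qed
    moreover have "((\<lambda>z. C * z) \<longlongrightarrow> C * 0) (at_right 0)"
      by (intro tendsto_intros)
    ultimately have "\<bar>c n - d n\<bar> \<le> C * 0"
      by (intro tendsto_lowerbound[of "\<lambda>z. C * z"]) auto
    then show ?case
      by simp
  qed
qed

theorem corollary6p4:
  shows "(\<exists>!v. has_asymp_expansion_at_right_0 V v) \<and>
    (\<forall>v. has_asymp_expansion_at_right_0 V v \<longrightarrow>
      (\<forall>n::nat. n \<ge> 1 \<longrightarrow>
         v (2 * n - 1) = (-1) ^ n / 2 \<and>
         v (2 * n) = (-1) ^ (n + 1) *
           (1 / real n +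
            (\<Sum>k=1..n. (-1) ^ k * real ((n + k - 1) choose (n - k)) *
               (bernoulli (2 * k) / real (2 * k))))))"
proof -
  have unique: "v = V_coeff" if "has_asymp_expansion_at_right_0 V v" for v
    using has_asymp_expansion_unique[OF that V_has_asymp_expansion] .
  show ?thesis
    using V_has_asymp_expansion V_coeff_odd V_coeff_even by (blast dest: unique)
qed

end
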